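(* Let $X\in\mathbb{R}^d$, $Y\in\mathbb{R}$, $H\in\mathbb{R}^q$, $I\in\mathbb{R}^m$ be generated by the linear structural causal model $$X := BX + AI + h(H,\epsilon^X),\qquad Y := X^\top\beta^* + g(H,\epsilon^Y),$$ where $B\in\mathbb{R}^{d\times d}$ with $\operatorname{Id}-B$ invertible, $A\in\mathbb{R}^{d\times m}$, $\beta^*\in\mathbb{R}^d$, $h,g$ are arbitrary measurable functions, $I,H,\epsilon^X,\epsilon^Y$ are jointly independent, and $\operatorname{Cov}[I]$ is invertible. Let $\mathcal{G}$ be the associated graph (defined in the context), assumed acyclic, let $\operatorname{PA}(Y):=\{j:\beta^*_j\neq0\}$, and let $C:=A^\top(\operatorname{Id}-B)^{-\top}$. Consider the graphical assumptions: (B1) there are at least $|\operatorname{PA}(Y)|$ pairwise disjoint (not sharing any node) directed paths in $\mathcal{G}$ from instrument nodes to nodes in $\operatorname{PA}(Y)$; (B2) with the graph $\mathcal{G}$ (i.e. the zero patterns of $A$, $B$, $\beta^*$) fixed, the non-zero entries of $\beta^*_{\operatorname{PA}(Y)}$ and the non-zero entries of $A$ and $B$ are randomly drawn from a distribution $\mu$ that is absolutely continuous with respect to Lebesgue measure (and independent of the other variables); (B3) for all $S\subseteq\{1,\dots,d\}$ with $|S|=|\operatorname{PA}(Y)|$ and $S\neq\operatorname{PA}(Y)$, at least one of: (i) $\operatorname{AN}_I[S]\neq\operatorname{AN}_I[\operatorname{PA}(Y)]$; (ii) the smallest set $T$ of nodes such that all directed paths from instrument nodes to $\operatorname{PA}(Y)$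 and from instrument nodes to $S$ go through $T$ has size at least $|\operatorname{PA}(Y)|+1$. Also consider (A1) $\operatorname{rank}(C_{\operatorname{PA}(Y)})=|\operatorname{PA}(Y)|$; (A2) for all $S\subseteq\{1,\dots,d\}$: if $\operatorname{rank}(C_S)\le\operatorname{rank}(C_{\operatorname{PA}(Y)})$ and $\operatorname{im}(C_S)\neq\operatorname{im}(C_{\operatorname{PA}(Y)})$, then $C_S w\neq C_{\operatorname{PA}(Y)}\beta^*_{\operatorname{PA}(Y)}$ for all $w\in\mathbb{R}^{|S|}$; (A3) for all $S\subseteq\{1,\dots,d\}$ with $|S|=|\operatorname{PA}(Y)|$ and $S\neq\operatorname{PA}(Y)$, $\operatorname{im}(C_S)\neq\operatorname{im}(C_{\operatorname{PA}(Y)})$. If (B1) and (B2) hold, then (A1) and (A2) hold $\mu$-almost surely. If, in addition, (B3) holds, then (A3) holds $\mu$-almost surely.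
   Context: The graph $\mathcal{G}$: it has a prediction node $X^j$ for each $j\in\{1,\dots,d\}$, an instrument node $k$ for each $k\in\{1,\dots,m\}$, and a node $Y$. There is a directed edge $X^i\to X^j$ iff $B_{ji}\neq0$, an edge $k\to X^j$ iff $A_{jk}\neq0$, and an edge $X^j\to Y$ iff $\beta^*_j\neq0$; there are no edges between instrument nodes, and hidden variables are not represented. $\operatorname{AN}(S)$ is the set of nodes having a directed path to a node in $S$ (a node is its own ancestor), and $\operatorname{AN}_I[S]:=\{k\in\{1,\dots,m\}: k\in\operatorname{AN}(S)\}$ is the set of instrument nodes that are ancestors of $S$. Variables $X^j$ are identified with their indices $j$. For a matrix $D$ and index set $S$, $D_S$ is the submatrix of columns indexed by $S$, and $\operatorname{im}(D)$ its column space. *)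

theory Defs
  imports "HOL-Probability.Probability"
begin

datatype ('d, 'm) node = XN 'd | IN 'm | YN

datatype ('d, 'm) pidx = Aent 'd 'm | Bent 'd 'd | Bet 'd

text \<open>Zero patterns: EA = {(j,k). A_jk ~= 0}, EB = {(j,i). B_ji ~= 0}, PA = {j. beta_j ~= 0}.\<close>
definition graphG :: "('d \<times> 'm) set \<Rightarrow> ('d \<times> 'd) set \<Rightarrow> 'd set
     \<Rightarrow> (('d, 'm) node \<times> ('d, 'm) node) set" where
  "graphG EA EB PA =
     {(XN i, XN j) | i j. (j, i) \<in> EB} \<union>
     {(IN k, XN j) | k j. (j, k) \<in> EA} \<union>
     {(XN j, YN) | j. j \<in> PA}"

definition dpath :: "('n \<times> 'n) set \<Rightarrow> 'n list \<Rightarrow> bool" where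
  "dpath G p \<longleftrightarrow> p \<noteq> [] \<and> successively (\<lambda>x y. (x, y) \<in> G) p"

definition is_instr :: "('d, 'm) node \<Rightarrow> bool" where
  "is_instr v \<longleftrightarrow> (\<exists>k. v = IN k)"

text \<open>Ancestors of a node set (a node is its own ancestor).\<close>
definition AN :: "('n \<times> 'n) set \<Rightarrow> 'n set \<Rightarrow> 'n set" where
  "AN G T = {v. \<exists>p. dpath G p \<and> hd p = v \<and> last p \<in> T}"

definition AN_I :: "(('d, 'm) node \<times> ('d, 'm) node) set \<Rightarrow> 'd set \<Rightarrow> 'm set" where
  "AN_I G S = {k. IN k \<in> AN G (XN ` S)}"

definition Amat :: "('d \<times> 'm) set \<Rightarrow> (('d::finite, 'm::finite) pidx \<Rightarrow> real) \<Rightarrow> real^'m^'d" where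
  "Amat EA \<theta> = (\<chi> j k. if (j, k) \<in> EA then \<theta> (Aent j k) else 0)"

definition Bmat :: "('d \<times> 'd) set \<Rightarrow> (('d::finite, 'm::finite) pidx \<Rightarrow> real) \<Rightarrow> real^'d^'d" where
  "Bmat EB \<theta> = (\<chi> j i. if (j, i) \<in> EB then \<theta> (Bent j i) else 0)"

definition betavec :: "'d set \<Rightarrow> (('d::finite, 'm::finite) pidx \<Rightarrow> real) \<Rightarrow> real^'d" where
  "betavec PA \<theta> = (\<chi> j. if j \<in> PA then \<theta> (Bet j) else 0)"

definition param_set :: "('d \<times> 'm) set \<Rightarrow> ('d \<times> 'd) set \<Rightarrow> 'd set \<Rightarrow> ('d, 'm) pidx set" where
  "param_set EA EB PA =
     (\<lambda>(j, k). Aent j k) ` EA \<union> (\<lambda>(j, i). Bent j i) ` EB \<union> Bet ` PA"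

definition Cmat :: "real^'m^'d \<Rightarrow> real^'d^'d \<Rightarrow> real^'d^'m" where
  "Cmat A B = transpose A ** transpose (matrix_inv (mat 1 - B))"

definition imS :: "real^'d^'m \<Rightarrow> 'd set \<Rightarrow> (real^'m) set" where
  "imS C S = span ((\<lambda>j. column j C) ` S)"

definition rankS :: "real^'d^'m \<Rightarrow> 'd set \<Rightarrow> nat" where
  "rankS C S = dim (imS C S)"

definition CSw :: "real^'d^'m \<Rightarrow> 'd set \<Rightarrow> ('d \<Rightarrow> real) \<Rightarrow> real^'m" where
  "CSw C S w = (\<Sum>j\<in>S. w j *\<^sub>R column j C)"

definition A1 :: "real^'d^'m \<Rightarrow> 'd set \<Rightarrow> bool" where
  "A1 C PA \<longleftrightarrow> rankS C PA = card PA"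

definition A2 :: "real^'d^'m \<Rightarrow> 'd set \<Rightarrow> real^'d \<Rightarrow> bool" where
  "A2 C PA \<beta> \<longleftrightarrow> (\<forall>S. rankS C S \<le> rankS C PA \<and> imS C S \<noteq> imS C PA \<longrightarrow>
       (\<forall>w. CSw C S w \<noteq> CSw C PA (\<lambda>j. \<beta> $ j)))"

definition A3 :: "real^'d^'m \<Rightarrow> 'd set \<Rightarrow> bool" where
  "A3 C PA \<longleftrightarrow> (\<forall>S. card S = card PA \<and> S \<noteq> PA \<longrightarrow> imS C S \<noteq> imS C PA)"

definition B1 :: "(('d, 'm) node \<times> ('d, 'm) node) set \<Rightarrow> 'd set \<Rightarrow> bool" where
  "B1 G PA \<longleftrightarrow> (\<exists>P. finite P \<and> card P \<ge> card PA \<and>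
      (\<forall>p\<in>P. dpath G p \<and> is_instr (hd p) \<and> last p \<in> XN ` PA) \<and>
      (\<forall>p\<in>P. \<forall>q\<in>P. p \<noteq> q \<longrightarrow> set p \<inter> set q = {}))"

definition B3 :: "(('d, 'm) node \<times> ('d, 'm) node) set \<Rightarrow> 'd set \<Rightarrow> bool" where
  "B3 G PA \<longleftrightarrow> (\<forall>S. card S = card PA \<and> S \<noteq> PA \<longrightarrow>
      AN_I G S \<noteq> AN_I G PA \<or>
      (\<forall>T. (\<forall>p. dpath G p \<and> is_instr (hd p) \<and> last p \<in> XN ` (PA \<union> S) \<longrightarrow> set p \<inter> T \<noteq> {})
           \<longrightarrow> card T \<ge> card PA + 1))"

end

theory Submission
  imports Defs "HOL-Computational_Algebra.Polynomial"
begin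

text \<open>The columns $c_j$ of $C$ satisfy $c_j = a_j + \sum_i B_{ji} c_i$, so on an acyclic graph they are
  polynomials in the parameters; hence each nondegeneracy condition (a nonzero Gram determinant) that
  holds at one parameter holds almost everywhere. Weight one on the edges of disjoint paths starting at
  instruments turns the columns at their end points into distinct unit vectors. This gives (A1) from
  (B1), and with Menger's theorem it gives $|PA| + 1$ independent columns indexed by $PA \cup S$ in case
  (ii) of (B3). In case (i), $\mathrm{AN}_I[S]$ is almost surely the set of coordinates on which
  $\mathrm{im}(C_S)$ does not vanish. For (A2), some column $c_j$ with $j \in PA$ lies outside
  $\mathrm{im}(C_S)$, so at $\beta = e_j$ the vector $C_{PA}\beta$ is outside, hence generically.\<close>

section \<open>Zero sets of polynomial functions\<close>

text \<open>Polynomial functions are generated as functions rather than taken from formal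
  polynomials, so closure and measurability are rule inductions. Arguments are total assignments;
  only coordinates in \<open>I\<close> may influence the value.\<close>

inductive polyfun :: "'i set \<Rightarrow> (('i \<Rightarrow> real) \<Rightarrow> real) \<Rightarrow> bool" for I where
  polyfun_const: "polyfun I (\<lambda>_. c)"
| polyfun_coord: "i \<in> I \<Longrightarrow> polyfun I (\<lambda>x. x i)"
| polyfun_add: "polyfun I f \<Longrightarrow> polyfun I g \<Longrightarrow> polyfun I (\<lambda>x. f x + g x)"
| polyfun_mult: "polyfun I f \<Longrightarrow> polyfun I g \<Longrightarrow> polyfun I (\<lambda>x. f x * g x)"

lemma polyfun_sum:
  "(\<And>a. a \<in> A \<Longrightarrow> polyfun I (f a)) \<Longrightarrow> polyfun I (\<lambda>x. \<Sum>a\<in>A. f a x)"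
  by (induction A rule: infinite_finite_induct) (auto intro: polyfun.intros)

lemma polyfun_prod:
  "(\<And>a. a \<in> A \<Longrightarrow> polyfun I (f a)) \<Longrightarrow> polyfun I (\<lambda>x. \<Prod>a\<in>A. f a x)"
  by (induction A rule: infinite_finite_induct) (auto intro: polyfun.intros)

lemma polyfun_det:
  fixes M :: "('i \<Rightarrow> real) \<Rightarrow> real^'n^'n"
  assumes "\<And>i j. polyfun I (\<lambda>x. M x $ i $ j)"
  shows "polyfun I (\<lambda>x. det (M x))"
  unfolding det_def by (intro polyfun_sum polyfun_mult polyfun_prod polyfun_const assms)

lemma polyfun_inner:
  fixes u v :: "('i \<Rightarrow> real) \<Rightarrow> real^'n"
  assumes "\<And>k. polyfun I (\<lambda>x. u x $ k)" "\<And>k. polyfun I (\<lambda>x. v x $ k)"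
  shows "polyfun I (\<lambda>x. u x \<bullet> v x)"
  unfolding inner_vec_def inner_real_def by (intro polyfun_sum polyfun_mult assms)

lemma polyfun_cong_on:
  "polyfun I f \<Longrightarrow> (\<And>i. i \<in> I \<Longrightarrow> x i = y i) \<Longrightarrow> f x = f y"
  by (induction rule: polyfun.induct) auto

lemma polyfun_measurable:
  "polyfun I f \<Longrightarrow> f \<in> borel_measurable (PiM I (\<lambda>_. lborel))"
  by (induction rule: polyfun.induct) (auto intro: borel_measurable_add borel_measurable_times measurable_component_singleton[where M="\<lambda>_. lborel", simplified])

text \<open>Singles out one variable: \<open>f\<close> becomes a univariate polynomial in
  \<open>x i\<close> whose coefficients depend polynomially on the remaining coordinates. This
  prepares the Fubini induction.\<close>

lemma polyfun_insert_poly: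
  assumes "polyfun (insert i J) f"
  shows "\<exists>p. (\<forall>x. f x = poly (p x) (x i)) \<and> (\<forall>n. polyfun J (\<lambda>x. coeff (p x) n))"
  using assms
proof (induction rule: polyfun.induct)
  case (polyfun_const c)
  show ?case
    by (intro exI[of _ "\<lambda>_. [:c:]"]) (auto intro: polyfun.intros)
next
  case (polyfun_coord j)
  show ?case
  proof (cases "j = i")
    case True
    then show ?thesis
      by (intro exI[of _ "\<lambda>_. [:0, 1:]"]) (auto intro: polyfun.intros)
  next
    case False
    then have "polyfun J (\<lambda>x. coeff [:x j:] n)" for n
      using polyfun_coord by (cases n) (auto intro: polyfun.intros)
    then show ?thesis
      by (intro exI[of _ "\<lambda>x. [:x j:]"]) auto
  qed
next
  case (polyfun_add f g)
  then obtain p q where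
    "\<forall>x. f x = poly (p x) (x i)" "\<forall>n. polyfun J (\<lambda>x. coeff (p x) n)"
    "\<forall>x. g x = poly (q x) (x i)" "\<forall>n. polyfun J (\<lambda>x. coeff (q x) n)" by blast
  then show ?case
    by (intro exI[of _ "\<lambda>x. p x + q x"]) (auto intro: polyfun.intros)
next
  case (polyfun_mult f g)
  then obtain p q where
    "\<forall>x. f x = poly (p x) (x i)" "\<forall>n. polyfun J (\<lambda>x. coeff (p x) n)"
    "\<forall>x. g x = poly (q x) (x i)" "\<forall>n. polyfun J (\<lambda>x. coeff (q x) n)" by blast
  then show ?case
    by (intro exI[of _ "\<lambda>x. p x * q x"]) (simp add: coeff_mult, intro allI polyfun_sum polyfun.polyfun_mult, auto)
qed

text \<open>Induction on the number of variables. A coefficient that is nonzero at \<open>x0\<close>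
  is nonzero almost everywhere by induction; wherever it is nonzero, the univariate polynomial in
  the new variable has finitely many roots, a null set.\<close>

lemma polyfun_AE_nonzero:
  assumes "finite I" "polyfun I f" "f x0 \<noteq> 0"
  shows "AE x in PiM I (\<lambda>_. lborel). f x \<noteq> 0"
  using assms
proof (induction I arbitrary: f x0)
  case empty
  have "f x = f x0" for x
    by (rule polyfun_cong_on[OF empty(1)]) simp
  then have "f x \<noteq> 0" for x using empty(2) by metis
  then show ?case by simp
next
  case (insert i J)
  interpret product_sigma_finite "\<lambda>_::'a. lborel :: real measure" ..
  let ?M = "PiM (insert i J) (\<lambda>_::'a. lborel :: real measure)"
  obtain p where f: "\<And>x. f x = poly (p x) (x i)" and p: "\<And>n. polyfun J (\<lambda>x. coeff (p x) n)"
    using polyfun_insert_poly[OF insert.prems(1)] by blast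
  \<comment> \<open>The coefficients involve only coordinates in \<open>J\<close>, so along the line
    in direction \<open>i\<close> the polynomial stays fixed.\<close>
  have p_upd: "p (x(i := y)) = p x" for x y
    using polyfun_cong_on[OF p, of "x(i := y)" x] \<open>i \<notin> J\<close>
    by (intro poly_eqI) (metis fun_upd_other)
  have "p x0 \<noteq> 0" using insert.prems(2) f by auto
  then obtain n where "coeff (p x0) n \<noteq> 0" by (metis leading_coeff_0_iff)
  then have "AE x in PiM J (\<lambda>_. lborel). coeff (p x) n \<noteq> 0"
    by (rule insert.IH[OF p])
  then have AE: "AE x in PiM J (\<lambda>_. lborel). (\<integral>\<^sup>+ y. indicator {x \<in> space ?M. f x = 0} (x(i := y)) \<partial>lborel) = 0"
  proof (eventually_elim)
    case (elim x)
    then have "p x \<noteq> 0" by auto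
    then have "finite {y. poly (p x) y = 0}" by (rule poly_roots_finite)
    then have "{y. poly (p x) y = 0} \<in> null_sets lborel"
      by (rule finite_imp_null_set_lborel)
    then have "AE y in lborel. poly (p x) y \<noteq> 0"
      by (auto dest: AE_not_in)
    then have "AE y in lborel. (indicator {x \<in> space ?M. f x = 0} (x(i := y)) :: ennreal) = 0"
      by eventually_elim (auto simp: f p_upd indicator_def)
    then have "(\<integral>\<^sup>+ y. indicator {x \<in> space ?M. f x = 0} (x(i := y)) \<partial>lborel) = (\<integral>\<^sup>+ y. 0 \<partial>(lborel::real measure))"
      by (rule nn_integral_cong_AE)
    then show ?case by simp
  qed
  have meas: "{x \<in> space ?M. f x = 0} \<in> sets ?M"
    using polyfun_measurable[OF insert.prems(1)] by measurable
  \<comment> \<open>Tonelli: coordinate \<open>i\<close> is integrated first, and by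
    \<open>AE\<close> that inner integral vanishes for almost every \<open>x\<close>.\<close>
  have "emeasure ?M {x \<in> space ?M. f x = 0}
      = (\<integral>\<^sup>+ x. (\<integral>\<^sup>+ y. indicator {x \<in> space ?M. f x = 0} (x(i := y)) \<partial>lborel) \<partial>PiM J (\<lambda>_. lborel))"
    using meas insert.hyps
    by (subst nn_integral_indicator[symmetric], simp, subst product_nn_integral_insert) auto
  also have "\<dots> = 0"
    using nn_integral_cong_AE[OF AE] by simp
  finally show ?case
    using meas by (intro AE_I[of _ _ "{x \<in> space ?M. f x = 0}"]) auto
qed

section \<open>Gram determinants\<close>

text \<open>Indices outside \<^term>\<open>S\<close> are padded with the identity, so that a determinant over the fixed
  index type decides independence for every \<^term>\<open>S\<close>.\<close>
definition gram :: "'d set \<Rightarrow> ('d \<Rightarrow> real^'m) \<Rightarrow> real^'d^'d" where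
  "gram S u = (\<chi> i j. if i \<in> S \<and> j \<in> S then u i \<bullet> u j else if i = j then 1 else 0)"

lemma polyfun_det_gram:
  assumes "\<And>i k. i \<in> S \<Longrightarrow> polyfun I (\<lambda>x. u x i $ k)"
  shows "polyfun I (\<lambda>x. det (gram S (u x)))"
proof (rule polyfun_det)
  fix i j
  show "polyfun I (\<lambda>x. gram S (u x) $ i $ j)"
    using assms by (cases "i \<in> S \<and> j \<in> S") (auto simp: gram_def intro: polyfun_inner polyfun_const)
qed

text \<open>\<open>independent\<close> speaks of a set and so ignores repeated vectors; injectivity
  on the index set is what turns it into independence of a family.\<close>

lemma inj_independent_iff:
  fixes u :: "'a \<Rightarrow> 'b::real_vector"
  assumes "finite S"
  shows "inj_on u S \<and> independent (u ` S) \<longleftrightarrow>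
         (\<forall>w. (\<Sum>i\<in>S. w i *\<^sub>R u i) = 0 \<longrightarrow> (\<forall>i\<in>S. w i = 0))" (is "?L \<longleftrightarrow> ?R")
proof
  assume L: ?L
  show ?R
  proof (intro allI impI ballI)
    fix w i assume 0: "(\<Sum>i\<in>S. w i *\<^sub>R u i) = 0" and "i \<in> S"
    have "(\<Sum>v\<in>u ` S. w (the_inv_into S u v) *\<^sub>R v) = 0"
      using L 0 by (subst sum.reindex) (auto simp: the_inv_into_f_f intro!: trans[OF sum.cong])
    then have "\<forall>v\<in>u ` S. w (the_inv_into S u v) = 0"
      using L assms independentD[of "u ` S" "u ` S" "\<lambda>v. w (the_inv_into S u v)"] by auto
    then show "w i = 0"
      using L \<open>i \<in> S\<close> by (auto simp: the_inv_into_f_f)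
  qed
next
  assume R: ?R
  have inj: "inj_on u S"
  proof (rule inj_onI, rule ccontr)
    fix a b assume ab: "a \<in> S" "b \<in> S" "u a = u b" "a \<noteq> b"
    \<comment> \<open>Equal vectors at two indices give the nontrivial relation with coefficients 1
      and -1.\<close>
    have "(\<Sum>i\<in>S. (if i = a then 1 else if i = b then -1 else 0) *\<^sub>R u i)
        = (\<Sum>i\<in>{a, b}. (if i = a then 1 else if i = b then -1 else 0) *\<^sub>R u i)"
      using ab assms by (intro sum.mono_neutral_right) auto
    also have "\<dots> = 0" using ab by auto
    finally show False
      using R[rule_format, of "\<lambda>i. if i = a then 1 else if i = b then -1 else 0" a] ab by auto
  qed
  moreover have "independent (u ` S)"
  proof (subst independent_explicit_finite_subsets, intro allI impI ballI)
    fix T w v assume T: "T \<subseteq> u ` S" "finite T" "(\<Sum>v\<in>T. w v *\<^sub>R v) = 0" "v \<in> T"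
    have "(\<Sum>i\<in>S. (if u i \<in> T then w (u i) else 0) *\<^sub>R u i)
        = (\<Sum>v\<in>u ` S. (if v \<in> T then w v else 0) *\<^sub>R v)"
      using inj by (simp add: sum.reindex)
    also have "\<dots> = (\<Sum>v\<in>T. w v *\<^sub>R v)"
      using T assms by (intro sum.mono_neutral_cong_right) auto
    finally show "w v = 0"
      using R[rule_format, of "\<lambda>i. if u i \<in> T then w (u i) else 0"] T by fastforce
  qed
  ultimately show ?L by simp
qed

text \<open>A kernel vector of the matrix vanishes outside \<open>S\<close> because of the identity
  padding. On \<open>S\<close> its combination of the \<open>u j\<close> is orthogonal to every
  \<open>u i\<close>, hence to itself, hence zero.\<close>

lemma det_gram_nonzero_iff:
  fixes u :: "'d::finite \<Rightarrow> real^'m"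
  shows "det (gram S u) \<noteq> 0 \<longleftrightarrow> inj_on u S \<and> independent (u ` S)"
proof -
  have gram_mult: "(gram S u *v x) $ i = (if i \<in> S then u i \<bullet> (\<Sum>j\<in>S. x $ j *\<^sub>R u j) else x $ i)" for x i
  proof -
    have "(gram S u *v x) $ i = (\<Sum>j\<in>UNIV. (if i \<in> S \<and> j \<in> S then u i \<bullet> u j else if i = j then 1 else 0) * x $ j)"
      by (simp add: matrix_vector_mult_def gram_def)
    also have "\<dots> = (if i \<in> S then (\<Sum>j\<in>S. (u i \<bullet> u j) * x $ j) else (\<Sum>j\<in>{i}. x $ j))"
      by (split if_split, intro conjI impI; intro sum.mono_neutral_cong_right) auto
    finally show ?thesis by (simp add: inner_sum_right mult.commute)
  qed
  have "det (gram S u) \<noteq> 0 \<longleftrightarrow> (\<forall>x. gram S u *v x = 0 \<longrightarrow> x = 0)"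
    by (metis invertible_det_nz invertible_left_inverse matrix_left_invertible_ker)
  also have "\<dots> \<longleftrightarrow> (\<forall>w. (\<Sum>i\<in>S. w i *\<^sub>R u i) = 0 \<longrightarrow> (\<forall>i\<in>S. w i = 0))"
  proof (intro iffI allI impI ballI)
    fix w i assume ker: "\<forall>x. gram S u *v x = 0 \<longrightarrow> x = 0"
      and 0: "(\<Sum>i\<in>S. w i *\<^sub>R u i) = 0" and "i \<in> S"
    let ?x = "\<chi> i. if i \<in> S then w i else 0"
    have "gram S u *v ?x = 0"
      using 0 by (auto simp: vec_eq_iff[of "gram S u *v ?x"] gram_mult)
    with ker have "?x = 0" by blast
    then have "?x $ i = 0" by simp
    then show "w i = 0" using \<open>i \<in> S\<close> by simp
  next
    fix x assume R: "\<forall>w. (\<Sum>i\<in>S. w i *\<^sub>R u i) = 0 \<longrightarrow> (\<forall>i\<in>S. w i = 0)"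
      and ker: "gram S u *v x = 0"
    let ?s = "\<Sum>j\<in>S. x $ j *\<^sub>R u j"
    have ker': "(if i \<in> S then u i \<bullet> ?s else x $ i) = 0" for i
      using ker by (metis gram_mult zero_index)
    have "?s \<bullet> ?s = (\<Sum>j\<in>S. x $ j * (u j \<bullet> ?s))"
      by (subst inner_sum_left) simp
    also have "\<dots> = 0"
      using ker' by (intro sum.neutral) (metis mult_zero_right)
    finally have "?s = 0" by simp
    with R have "\<forall>i\<in>S. x $ i = 0" by blast
    with ker' show "x = 0"
      unfolding vec_eq_iff by (metis zero_index)
  qed
  finally show ?thesis by (simp add: inj_independent_iff)
qed

section \<open>Menger's theorem\<close>

lemma dpath_mono: "dpath E p \<Longrightarrow> E \<subseteq> F \<Longrightarrow> dpath F p"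
  unfolding dpath_def by (auto elim: successively_mono)

lemma dpath_appendD1: "dpath E (p @ v # q) \<Longrightarrow> dpath E (p @ [v])"
  by (auto simp: dpath_def successively_append_iff)

lemma dpath_appendD2: "dpath E (p @ v # q) \<Longrightarrow> dpath E (v # q)"
  by (auto simp: dpath_def successively_append_iff)

lemma dpath_appendI: "dpath E (p @ [v]) \<Longrightarrow> dpath E (v # q) \<Longrightarrow> dpath E (p @ v # q)"
  by (auto simp: dpath_def successively_append_iff)

text \<open>Using the new edge means taking a step out of \<open>x\<close>. With
  \<open>butlast\<close> the path may still end in \<open>x\<close>, which is what cutting a path at
  its first visit to \<open>x\<close> produces.\<close>

lemma dpath_insert_source_notin:
  "dpath (insert (x, y) E) p \<Longrightarrow> x \<notin> set (butlast p) \<Longrightarrow> dpath E p"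
  by (induction p rule: induct_list012) (auto simp: dpath_def split: if_splits)

lemma dpath_insert_target_notin:
  "dpath (insert (x, y) E) p \<Longrightarrow> y \<notin> set (tl p) \<Longrightarrow> dpath E p"
  by (induction p rule: induct_list012) (auto simp: dpath_def)

text \<open>Along a path any two positions are related by the transitive closure, which is
  irreflexive.\<close>

lemma acyclic_dpath_distinct:
  assumes "acyclic E" "dpath E p"
  shows "distinct p"
proof -
  have "successively (\<lambda>x y. (x, y) \<in> E\<^sup>+) p"
    using assms(2) unfolding dpath_def by (auto elim: successively_mono)
  moreover have "transp (\<lambda>x y. (x, y) \<in> E\<^sup>+)"
    by (auto intro: transpI)
  ultimately have "sorted_wrt (\<lambda>x y. (x, y) \<in> E\<^sup>+) p"
    by (simp add: successively_conv_sorted_wrt)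
  then show ?thesis
    using assms(1) by (induction p) (auto simp: acyclic_def)
qed

definition separates :: "('n \<times> 'n) set \<Rightarrow> 'n set \<Rightarrow> 'n set \<Rightarrow> 'n set \<Rightarrow> bool" where
  "separates E A B T \<longleftrightarrow>
     (\<forall>p. dpath E p \<and> hd p \<in> A \<and> last p \<in> B \<longrightarrow> set p \<inter> T \<noteq> {})"

definition disjoint_paths :: "('n \<times> 'n) set \<Rightarrow> 'n set \<Rightarrow> 'n set \<Rightarrow> 'n list set \<Rightarrow> bool" where
  "disjoint_paths E A B P \<longleftrightarrow> finite P \<and>
     (\<forall>p\<in>P. dpath E p \<and> distinct p \<and> hd p \<in> A \<and> last p \<in> B) \<and>
     (\<forall>p\<in>P. \<forall>q\<in>P. p \<noteq> q \<longrightarrow> set p \<inter> set q = {})"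

lemma separates_insert_source:
  assumes "separates E A B S"
  shows "separates (insert (x, y) E) A B (insert x S)"
  unfolding separates_def
proof (intro allI impI)
  fix p assume p: "dpath (insert (x, y) E) p \<and> hd p \<in> A \<and> last p \<in> B"
  show "set p \<inter> insert x S \<noteq> {}"
  proof (cases "x \<in> set p")
    case False
    then have "dpath E p"
      using p dpath_insert_source_notin[of x y E p] by (auto dest: in_set_butlastD)
    then show ?thesis
      using p assms[unfolded separates_def, rule_format, of p] by auto
  qed auto
qed

lemma separates_insert_target:
  assumes "separates E A B S"
  shows "separates (insert (x, y) E) A B (insert y S)"
  unfolding separates_def
proof (intro allI impI)
  fix p assume p: "dpath (insert (x, y) E) p \<and> hd p \<in> A \<and> last p \<in> B"
  show "set p \<inter> insert y S \<noteq> {}"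
  proof (cases "y \<in> set p")
    case False
    then have "dpath E p"
      using p dpath_insert_target_notin[of x y E p] by (cases p) auto
    then show ?thesis
      using p assms[unfolded separates_def, rule_format, of p] by auto
  qed auto
qed

text \<open>Cut a path from \<open>A\<close> to \<open>B\<close> at its first node in
  \<open>insert x S\<close>. The initial piece can meet \<open>x\<close> only at its end, so it
  avoids the new edge, lies in \<open>E\<close>, and must meet \<open>T\<close>.\<close>

lemma separates_prefix:
  assumes sep: "separates (insert (x, y) E) A B (insert x S)" 
    and T: "separates E A (insert x S) T"
  shows "separates (insert (x, y) E) A B T"
  unfolding separates_def
proof (intro allI impI)
  fix p assume p: "dpath (insert (x, y) E) p \<and> hd p \<in> A \<and> last p \<in> B"
  then have "\<exists>v\<in>set p. v \<in> insert x S"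
    using sep[unfolded separates_def, rule_format, of p] by auto
  then obtain a v b where ab: "p = a @ v # b" "v \<in> insert x S" "\<forall>u\<in>set a. u \<notin> insert x S"
    using split_list_first_prop[of p "\<lambda>v. v \<in> insert x S"] by blast
  have "dpath (insert (x, y) E) (a @ [v])"
    using p ab(1) by (auto intro: dpath_appendD1)
  then have "dpath E (a @ [v])"
    using ab(3) dpath_insert_source_notin[of x y E "a @ [v]"] by auto
  moreover have "hd (a @ [v]) \<in> A" using p ab(1) by (cases a) auto
  ultimately have "set (a @ [v]) \<inter> T \<noteq> {}"
    using T[unfolded separates_def, rule_format, of "a @ [v]"] ab(2) by simp
  then show "set p \<inter> T \<noteq> {}" using ab(1) by auto
qed

text \<open>The mirror image: cut at the last node in \<open>insert y S\<close>, so that the final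
  piece can meet \<open>y\<close> only at its start.\<close>

lemma separates_suffix:
  assumes sep: "separates (insert (x, y) E) A B (insert y S)" 
    and T: "separates E (insert y S) B T"
  shows "separates (insert (x, y) E) A B T"
  unfolding separates_def
proof (intro allI impI)
  fix p assume p: "dpath (insert (x, y) E) p \<and> hd p \<in> A \<and> last p \<in> B"
  then have "\<exists>v\<in>set p. v \<in> insert y S"
    using sep[unfolded separates_def, rule_format, of p] by auto
  then obtain a v b where ab: "p = a @ v # b" "v \<in> insert y S" "\<forall>u\<in>set b. u \<notin> insert y S"
    using split_list_last_prop[of p "\<lambda>v. v \<in> insert y S"] by blast
  have "dpath (insert (x, y) E) (v # b)"
    using p ab(1) by (auto intro: dpath_appendD2)
  then have "dpath E (v # b)"
    using ab(3) dpath_insert_target_notin[of x y E "v # b"] by auto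
  moreover have "last (v # b) \<in> B" using p ab(1) by auto
  ultimately have "set (v # b) \<inter> T \<noteq> {}"
    using T[unfolded separates_def, rule_format, of "v # b"] ab(2) by simp
  then show "set p \<inter> T \<noteq> {}" using ab(1) by auto
qed

text \<open>With as many paths as targets, the distinct end points exhaust \<open>B\<close>, so the
  paths can be indexed by them. No path visits a second node of \<open>B\<close>, because that node
  already ends another path.\<close>

lemma disjoint_paths_last:
  assumes P: "disjoint_paths E A B P" and "finite B" "card P = card B"
  obtains f where "\<And>s. s \<in> B \<Longrightarrow> f s \<in> P" "\<And>s. s \<in> B \<Longrightarrow> last (f s) = s"
    "\<And>s v. s \<in> B \<Longrightarrow> v \<in> B \<Longrightarrow> v \<in> set (f s) \<Longrightarrow> v = s"
proof -
  have "inj_on last P"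
  proof (rule inj_onI, rule ccontr)
    fix p q assume "p \<in> P" "q \<in> P" "last p = last q" "p \<noteq> q"
    then show False
      using P unfolding disjoint_paths_def dpath_def by (metis disjoint_iff last_in_set)
  qed
  moreover have "last ` P \<subseteq> B" using P by (auto simp: disjoint_paths_def)
  ultimately have "last ` P = B"
    using assms(2,3) by (simp add: card_image card_subset_eq)
  then have f: "\<exists>f. \<forall>s\<in>B. f s \<in> P \<and> last (f s) = s"
    by (intro bchoice) auto
  then obtain f where f: "\<forall>s\<in>B. f s \<in> P \<and> last (f s) = s" by blast
  moreover have "v = s" if "s \<in> B" "v \<in> B" "v \<in> set (f s)" for s v
    using f that P unfolding disjoint_paths_def dpath_def by (metis disjoint_iff last_in_set)
  ultimately show ?thesis using that[of f] by blast
qed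

lemma disjoint_paths_hd:
  assumes P: "disjoint_paths E A B P" and "finite A" "card P = card A"
  obtains f where "\<And>s. s \<in> A \<Longrightarrow> f s \<in> P" "\<And>s. s \<in> A \<Longrightarrow> hd (f s) = s"
    "\<And>s v. s \<in> A \<Longrightarrow> v \<in> A \<Longrightarrow> v \<in> set (f s) \<Longrightarrow> v = s"
proof -
  have "inj_on hd P"
  proof (rule inj_onI, rule ccontr)
    fix p q assume "p \<in> P" "q \<in> P" "hd p = hd q" "p \<noteq> q"
    then show False
      using P unfolding disjoint_paths_def dpath_def by (metis disjoint_iff hd_in_set)
  qed
  moreover have "hd ` P \<subseteq> A" using P by (auto simp: disjoint_paths_def)
  ultimately have "hd ` P = A"
    using assms(2,3) by (simp add: card_image card_subset_eq)
  then have f: "\<exists>f. \<forall>s\<in>A. f s \<in> P \<and> hd (f s) = s"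
    by (intro bchoice) auto
  then obtain f where f: "\<forall>s\<in>A. f s \<in> P \<and> hd (f s) = s" by blast
  moreover have "v = s" if "s \<in> A" "v \<in> A" "v \<in> set (f s)" for s v
    using f that P unfolding disjoint_paths_def dpath_def by (metis disjoint_iff hd_in_set)
  ultimately show ?thesis using that[of f] by blast
qed

text \<open>Goering's induction on the number of edges: deleting an edge
  $(x,y)$ either keeps all separators large, or leaves a separator $S$ with $k-1$ nodes, and then
  paths from $A$ to $S \cup \{x\}$ and from $S \cup \{y\}$ to $B$ are glued together.\<close>
theorem menger:
  assumes "finite E" "finite A" "finite B"
    and "\<And>T. finite T \<Longrightarrow> separates E A B T \<Longrightarrow> k \<le> card T"
  shows "\<exists>P. disjoint_paths E A B P \<and> card P = k"
  using assms
proof (induction E arbitrary: A B)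
  case empty
  \<comment> \<open>Without edges every path is a single node.\<close>
  have "separates {} A B (A \<inter> B)"
    unfolding separates_def
  proof (intro allI impI)
    fix p assume "dpath {} p \<and> hd p \<in> A \<and> last p \<in> B"
    then show "set p \<inter> (A \<inter> B) \<noteq> {}"
      by (cases p rule: remdups_adj.cases) (auto simp: dpath_def)
  qed
  then have "k \<le> card (A \<inter> B)" using empty by auto
  then obtain K where K: "K \<subseteq> A \<inter> B" "card K = k" "finite K"
    by (metis obtain_subset_with_card_n)
  have "disjoint_paths {} A B ((\<lambda>v. [v]) ` K)"
    using K by (auto simp: disjoint_paths_def dpath_def)
  moreover have "card ((\<lambda>v. [v]) ` K) = k"
    using K by (auto simp: card_image inj_on_def)
  ultimately show ?case by blast
next
  case (insert e E)
  obtain x y where e: "e = (x, y)" by (cases e)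
  show ?case
  proof (cases "\<forall>T. finite T \<longrightarrow> separates E A B T \<longrightarrow> k \<le> card T")
    case True
    then obtain P where "disjoint_paths E A B P" "card P = k"
      using insert.IH[of A B] insert.prems by blast
    moreover from this have "disjoint_paths (insert e E) A B P"
      unfolding disjoint_paths_def by (meson dpath_mono subset_insertI)
    ultimately show ?thesis by blast
  next
    case False
    then obtain S where S: "finite S" "separates E A B S" "card S < k" by fastforce
    have sepx: "separates (insert (x, y) E) A B (insert x S)"
      and sepy: "separates (insert (x, y) E) A B (insert y S)"
      using S(2) by (rule separates_insert_source separates_insert_target)+
    \<comment> \<open>Adding either end of the edge to \<open>S\<close> gives a separator of the
      larger graph, so at least \<open>k\<close> nodes; as \<open>S\<close> has fewer than
      \<open>k\<close>, both ends are new and both counts are exactly \<open>k\<close>.\<close>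
    have card_x: "x \<notin> S" "card (insert x S) = k" and card_y: "y \<notin> S" "card (insert y S) = k"
      using insert.prems(3)[of "insert x S"] insert.prems(3)[of "insert y S"] sepx sepy S
      by (auto simp: e card_insert_if split: if_splits)
    obtain P1 where P1: "disjoint_paths E A (insert x S) P1" "card P1 = k"
      using insert.IH[of A "insert x S"] insert.prems S(1) separates_prefix[OF sepx] e by blast
    obtain P2 where P2: "disjoint_paths E (insert y S) B P2" "card P2 = k"
      using insert.IH[of "insert y S" B] insert.prems S(1) separates_suffix[OF sepy] e by blast
    obtain f where f: "\<And>s. s \<in> insert x S \<Longrightarrow> f s \<in> P1" "\<And>s. s \<in> insert x S \<Longrightarrow> last (f s) = s"
      "\<And>s v. s \<in> insert x S \<Longrightarrow> v \<in> insert x S \<Longrightarrow> v \<in> set (f s) \<Longrightarrow> v = s"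
      using disjoint_paths_last[OF P1(1)] S(1) P1(2) card_x(2) by (metis finite_insert)
    obtain g where g: "\<And>s. s \<in> insert y S \<Longrightarrow> g s \<in> P2" "\<And>s. s \<in> insert y S \<Longrightarrow> hd (g s) = s"
      "\<And>s v. s \<in> insert y S \<Longrightarrow> v \<in> insert y S \<Longrightarrow> v \<in> set (g s) \<Longrightarrow> v = s"
      using disjoint_paths_hd[OF P2(1)] S(1) P2(2) card_y(2) by (metis finite_insert)
    have fp: "dpath E (f s)" "distinct (f s)" "hd (f s) \<in> A" "f s \<noteq> []" if "s \<in> insert x S" for s
      using f(1)[OF that] P1(1) by (auto simp: disjoint_paths_def dpath_def)
    have gp: "dpath E (g s)" "distinct (g s)" "last (g s) \<in> B" "g s \<noteq> []" if "s \<in> insert y S" for s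
      using g(1)[OF that] P2(1) by (auto simp: disjoint_paths_def dpath_def)
    \<comment> \<open>At a meeting node outside \<open>S\<close>, splicing the two paths gives a
      path from \<open>A\<close> to \<open>B\<close> in \<open>E\<close>, which must hit
      \<open>S\<close>. The hit would be the end of \<open>f s\<close> or the start of
      \<open>g t\<close>, so that node would occur twice on a path without repetition.\<close>
    have meet: "v \<in> S" if s: "s \<in> insert x S" and t: "t \<in> insert y S"
      and v: "v \<in> set (f s)" "v \<in> set (g t)" for s t v
    proof (rule ccontr)
      assume "v \<notin> S"
      obtain a b where ab: "f s = a @ v # b" using v(1) by (meson split_list)
      obtain c d where cd: "g t = c @ v # d" using v(2) by (meson split_list)
      have "dpath E (a @ v # d)"
        using fp(1)[OF s] gp(1)[OF t] ab cd by (metis dpath_appendD1 dpath_appendD2 dpath_appendI)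
      moreover have "hd (a @ v # d) \<in> A" using fp(3)[OF s] ab by (cases a) auto
      moreover have "last (a @ v # d) \<in> B" using gp(3)[OF t] cd by auto
      ultimately obtain z where z: "z \<in> S" "z \<in> set (a @ v # d)"
        using S(2)[unfolded separates_def, rule_format, of "a @ v # d"] by blast
      then consider "z \<in> set a" | "z \<in> set d" using \<open>v \<notin> S\<close> by auto
      then show False
      proof cases
        case 1
        then have "z = last (f s)" using f(2)[OF s] f(3)[OF s, of z] s z(1) ab by auto
        then have "z \<in> set (v # b)" using ab by (metis last_appendR last_in_set list.distinct(1))
        then show False using 1 fp(2)[OF s] ab by auto
      next
        case 2
        then have "z = hd (g t)" using g(2)[OF t] g(3)[OF t, of z] t z(1) cd by auto
        then have "z \<in> set (c @ [v])" using cd by (cases c) auto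
        then show False using 2 gp(2)[OF t] cd by auto
      qed
    qed
    \<comment> \<open>The front path ending in \<open>x\<close> crosses the new edge and continues
      with the path from \<open>y\<close>. Any other front path ends in a node \<open>s\<close> of
      \<open>S\<close> and continues with the path from \<open>s\<close>, whose first node is
      dropped to avoid a repetition.\<close>
    define t where "t s = (if s = x then y else s)" for s
    define h where "h s = (if s = x then g y else tl (g s))" for s
    have t: "t s \<in> insert y S" if "s \<in> insert x S" for s using that by (auto simp: t_def)
    have t_inj: "t s \<noteq> t s'" if "s \<in> insert x S" "s' \<in> insert x S" "s \<noteq> s'" for s s'
      using that card_y(1) by (auto simp: t_def)
    have h_sub: "set (h s) \<subseteq> set (g (t s))" for s
      by (cases "g s") (auto simp: h_def t_def)
    have ff: "set (f s) \<inter> set (f s') = {}" if "s \<in> insert x S" "s' \<in> insert x S" "s \<noteq> s'" for s s'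
      using P1(1) f(1,2) that unfolding disjoint_paths_def by metis
    have gg: "set (g s) \<inter> set (g s') = {}" if "s \<in> insert y S" "s' \<in> insert y S" "s \<noteq> s'" for s s'
      using P2(1) g(1,2) that unfolding disjoint_paths_def by metis
    have hh: "set (h s) \<inter> set (h s') = {}" if "s \<in> insert x S" "s' \<in> insert x S" "s \<noteq> s'" for s s'
      using gg[OF t[OF that(1)] t[OF that(2)] t_inj[OF that]] h_sub by blast
    \<comment> \<open>A common node lies in \<open>S\<close>, so it is the first node of the back
      path. That node is \<open>y\<close>, which is not in \<open>S\<close>, or it has been dropped
      by \<open>tl\<close>.\<close>
    have fh: "set (f s) \<inter> set (h s') = {}" if s: "s \<in> insert x S" and s': "s' \<in> insert x S" for s s'
    proof (rule ccontr)
      assume "set (f s) \<inter> set (h s') \<noteq> {}"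
      then obtain v where v: "v \<in> set (f s)" "v \<in> set (h s')" by blast
      then have vg: "v \<in> set (g (t s'))" using h_sub by blast
      then have "v \<in> S" using meet[OF s t[OF s'] v(1)] by blast
      then have "v = t s'" using g(3)[OF t[OF s'] _ vg] by blast
      with \<open>v \<in> S\<close> card_y have "s' \<noteq> x" by (auto simp: t_def)
      then have "v = s'" "v \<in> set (tl (g s'))" "s' \<in> insert y S"
        using \<open>v = t s'\<close> v(2) s' by (auto simp: t_def h_def)
      then show False
        using gp(2,4) g(2) by (metis distinct.simps(2) list.collapse)
    qed
    define r where "r s = f s @ h s" for s
    have r: "dpath (insert e E) (r s)" "distinct (r s)" "hd (r s) \<in> A" "last (r s) \<in> B"
      if s: "s \<in> insert x S" for s
    proof -
      have E: "successively (\<lambda>u v. (u, v) \<in> insert e E) (f s)"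
        "successively (\<lambda>u v. (u, v) \<in> insert e E) (g (t s))"
        using fp(1)[OF s] gp(1)[OF t[OF s]] by (auto simp: dpath_def elim: successively_mono)
      have "dpath (insert e E) (r s) \<and> distinct (h s) \<and> last (r s) \<in> B"
      proof (cases "s = x")
        case True
        then show ?thesis
          using E fp[OF s] gp[of y] f(2)[OF s] g(2)[of y]
          by (auto simp: r_def h_def t_def dpath_def successively_append_iff e)
      next
        case False
        then have sS: "s \<in> insert y S" "t s = s" using s by (auto simp: t_def)
        \<comment> \<open>The list \<open>q\<close> may be empty: then \<open>s\<close> itself lies
          in \<open>B\<close> and the glued path ends there.\<close>
        then obtain q where q: "g s = s # q" using g(2) gp(4) by (metis list.collapse)
        then show ?thesis
          using False E fp[OF s] gp[OF sS(1)] f(2)[OF s] sS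
          by (auto simp: r_def h_def dpath_def successively_append_iff successively_Cons last_append split: if_splits)
      qed
      then show "dpath (insert e E) (r s)" "distinct (r s)" "last (r s) \<in> B"
        using fp(2)[OF s] fh[OF s s] by (auto simp: r_def)
      show "hd (r s) \<in> A" using fp[OF s] by (simp add: r_def)
    qed
    have disj: "set (r s) \<inter> set (r s') = {}" if "s \<in> insert x S" "s' \<in> insert x S" "s \<noteq> s'" for s s'
      using ff[OF that] hh[OF that] fh[of s s'] fh[of s' s] that by (auto simp: r_def)
    have "inj_on r (insert x S)"
    proof (rule inj_onI, rule ccontr)
      fix s s' assume "s \<in> insert x S" "s' \<in> insert x S" "r s = r s'" "s \<noteq> s'"
      then show False using disj[of s s'] fp(4)[of s] by (simp add: r_def)
    qed
    then have "card (r ` insert x S) = k"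
      using card_x by (simp only: card_image)
    moreover have "disjoint_paths (insert e E) A B (r ` insert x S)"
      unfolding disjoint_paths_def
    proof (intro conjI ballI impI)
      show "finite (r ` insert x S)" using S(1) by simp
    next
      fix p q assume "p \<in> r ` insert x S" "q \<in> r ` insert x S" "p \<noteq> q"
      then show "set p \<inter> set q = {}" using disj by (elim imageE) metis
    qed (use r in blast)+
    ultimately show ?thesis by blast
  qed
qed

section \<open>Generic columns of an acyclic model\<close>

lemma is_instr_iff: "is_instr v \<longleftrightarrow> v \<in> range IN"
  by (auto simp: is_instr_def)

lemma finite_graphG: "finite (graphG EA EB (PA :: 'd set) :: (('d::finite, 'm::finite) node \<times> _) set)"
proof -
  have "graphG EA EB PA = (\<lambda>(j, i). (XN i, XN j)) ` EB \<union> (\<lambda>(j, k). (IN k, XN j)) ` EA \<union> (\<lambda>j. (XN j, YN)) ` PA"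
    by (force simp: graphG_def)
  then show ?thesis by simp
qed

locale acyclic_scm =
  fixes EA :: "('d::finite \<times> 'm::finite) set" and EB :: "('d \<times> 'd) set" and PA :: "'d set"
  assumes acyc: "acyclic (graphG EA EB PA)"
begin

section \<open>Total effects of the instruments on the predictors\<close>

abbreviation "G \<equiv> graphG EA EB PA"
abbreviation "M0 \<equiv> PiM (param_set EA EB PA) (\<lambda>_. lborel :: real measure)"

definition total :: "(('d, 'm) pidx \<Rightarrow> real) \<Rightarrow> 'd \<Rightarrow> real^'m" where
  "total \<theta> j = column j (Cmat (Amat EA \<theta>) (Bmat EB \<theta>))"

text \<open>A pair \<open>(j, i)\<close> of \<open>EB\<close> stands for the edge from
  \<open>i\<close> to \<open>j\<close>, so the converse relation points along edges. Its
  well-foundedness allows induction from parents to children.\<close>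

lemma wf_EB: "wf (EB\<inverse>)"
proof -
  have "(XN i, XN j) \<in> G\<^sup>+" if "(i, j) \<in> (EB\<inverse>)\<^sup>+" for i j
    using that
  proof induction
    case (base j)
    then show ?case by (auto simp: graphG_def)
  next
    case (step j l)
    then have "(XN j, XN l) \<in> G" by (auto simp: graphG_def)
    with step.IH show ?case by (rule trancl_into_trancl)
  qed
  then have "acyclic (EB\<inverse>)"
    using acyc unfolding acyclic_def by blast
  then show ?thesis by (simp add: finite_acyclic_wf)
qed

text \<open>Each entry of a kernel vector is a combination of the entries at its parents, so all
  vanish by induction. Thus \<open>matrix_inv\<close> is a genuine inverse at every
  parameter.\<close>

lemma invertible_mat1_minus_Bmat: "invertible (mat 1 - Bmat EB \<theta>)"
proof -
  have "x = 0" if "(mat 1 - Bmat EB \<theta>) *v x = 0" for x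
  proof -
    have x: "x $ j = (\<Sum>i\<in>UNIV. Bmat EB \<theta> $ j $ i * x $ i)" for j
    proof -
      have "x = Bmat EB \<theta> *v x"
        using that by (simp add: matrix_vector_mult_diff_rdistrib)
      then have "x $ j = (Bmat EB \<theta> *v x) $ j" by simp
      then show ?thesis by (simp add: matrix_vector_mult_def)
    qed
    have "x $ j = 0" for j
    proof (induction j rule: wf_induct_rule[OF wf_EB])
      case (1 j)
      then show ?case by (subst x) (auto intro!: sum.neutral simp: Bmat_def)
    qed
    then show ?thesis by (simp add: vec_eq_iff)
  qed
  then show ?thesis
    by (metis invertible_left_inverse matrix_left_invertible_ker)
qed

text \<open>Row \<open>j\<close> of the identity (Id - B) D = A, where D is the transpose of
  \<open>C\<close>. From here on this recursion replaces the matrix inverse.\<close>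

lemma total_rec:
  "total \<theta> j $ k = Amat EA \<theta> $ j $ k + (\<Sum>i\<in>UNIV. Bmat EB \<theta> $ j $ i * total \<theta> i $ k)"
proof -
  let ?A = "Amat EA \<theta>" and ?B = "Bmat EB \<theta>"
  let ?D = "matrix_inv (mat 1 - ?B) ** ?A"
  have D: "total \<theta> j $ k = ?D $ j $ k" for j
    by (simp add: total_def column_def Cmat_def matrix_transpose_mul[symmetric]) (simp add: transpose_def)
  have "(mat 1 - ?B) ** matrix_inv (mat 1 - ?B) = mat 1"
    using someI_ex[OF invertible_mat1_minus_Bmat[of \<theta>, unfolded invertible_def]]
    by (simp add: matrix_inv_def)
  then have "(mat 1 - ?B) ** ?D = ?A" by (simp add: matrix_mul_assoc)
  then have "?A $ j $ k = ((mat 1 - ?B) ** ?D) $ j $ k" by simp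
  also have "\<dots> = (\<Sum>i\<in>UNIV. (mat 1 - ?B) $ j $ i * ?D $ i $ k)"
    by (simp add: matrix_matrix_mult_def)
  also have "\<dots> = (mat 1 ** ?D) $ j $ k - (\<Sum>i\<in>UNIV. ?B $ j $ i * ?D $ i $ k)"
    by (subst matrix_matrix_mult_def) (simp add: left_diff_distrib sum_subtractf)
  finally show ?thesis by (simp add: D)
qed

text \<open>The columns ignore the \<open>Bet\<close> coordinates, so these can be altered while the
  columns stay fixed.\<close>

lemma total_cong:
  "(\<And>j k. \<theta> (Aent j k) = \<theta>' (Aent j k)) \<Longrightarrow> (\<And>j i. \<theta> (Bent j i) = \<theta>' (Bent j i)) \<Longrightarrow>
    total \<theta> = total \<theta>'"
  by (intro ext) (simp add: total_def Amat_def Bmat_def cong: if_cong)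

lemma finite_param_set: "finite (param_set EA EB PA)"
  by (simp add: param_set_def)

text \<open>Unfolding the recursion over the parents uses only sums and products.\<close>

lemma polyfun_total: "polyfun (param_set EA EB PA) (\<lambda>\<theta>. total \<theta> j $ k)"
proof (induction j rule: wf_induct_rule[OF wf_EB])
  case (1 j)
  have "polyfun (param_set EA EB PA) (\<lambda>\<theta>. Amat EA \<theta> $ j $ k)"
    by (cases "(j, k) \<in> EA") (auto simp: Amat_def param_set_def intro!: polyfun_const polyfun_coord)
  moreover have "polyfun (param_set EA EB PA) (\<lambda>\<theta>. Bmat EB \<theta> $ j $ i * total \<theta> i $ k)" for i
  proof (cases "(j, i) \<in> EB")
    case True
    then show ?thesis
      using 1[of i] by (auto simp: Bmat_def param_set_def intro!: polyfun_mult polyfun_coord)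
  next
    case False
    then show ?thesis by (auto simp: Bmat_def intro: polyfun_const)
  qed
  ultimately show ?case
    by (subst total_rec) (intro polyfun_add polyfun_sum)
qed

text \<open>A nonzero entry comes from a direct edge or from a parent with a nonzero entry, whose
  path is then extended by one edge.\<close>

lemma total_nonzero_imp_dpath:
  assumes "total \<theta> j $ k \<noteq> 0"
  shows "\<exists>p. dpath G p \<and> hd p = IN k \<and> last p = XN j"
  using assms
proof (induction j rule: wf_induct_rule[OF wf_EB])
  case (1 j)
  show ?case
  proof (cases "(j, k) \<in> EA")
    case True
    then have "dpath G [IN k, XN j]" by (auto simp: dpath_def graphG_def)
    then show ?thesis by (intro exI[of _ "[IN k, XN j]"]) auto
  next
    case False
    then have "(\<Sum>i\<in>UNIV. Bmat EB \<theta> $ j $ i * total \<theta> i $ k) \<noteq> 0"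
      using 1(2) by (subst (asm) total_rec) (simp add: Amat_def)
    then obtain i where "Bmat EB \<theta> $ j $ i * total \<theta> i $ k \<noteq> 0"
      by (meson sum.neutral)
    then have i: "(j, i) \<in> EB" "total \<theta> i $ k \<noteq> 0" by (auto simp: Bmat_def split: if_splits)
    then obtain p where "dpath G p" "hd p = IN k" "last p = XN i" using 1(1)[of i] by auto
    moreover have "(XN i, XN j) \<in> G" using i by (auto simp: graphG_def)
    ultimately show ?thesis
      by (intro exI[of _ "p @ [XN j]"]) (auto simp: dpath_def successively_append_iff)
  qed
qed

text \<open>Give weight 1 to the edges on the paths and weight 0 to all others: then each node on a path
  is influenced by the instrument at the start of its path and by nothing else.\<close>
lemma disjoint_paths_total:
  assumes P: "disjoint_paths G (range IN) B P"
  obtains \<theta> where "\<And>p k j. p \<in> P \<Longrightarrow> hd p = IN k \<Longrightarrow> XN j \<in> set p \<Longrightarrow> total \<theta> j = axis k 1"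
proof
  \<comment> \<open>The edges that are consecutive on some path; exactly these receive weight
    1.\<close>
  define F where "F = {(u, v). \<exists>p\<in>P. \<exists>a b. p = a @ u # v # b}"
  define \<theta> :: "('d, 'm) pidx \<Rightarrow> real" where
    "\<theta> x = (case x of Aent j k \<Rightarrow> if (IN k, XN j) \<in> F then 1 else 0
                   | Bent j i \<Rightarrow> if (XN i, XN j) \<in> F then 1 else 0 | Bet j \<Rightarrow> 0)" for x
  fix p k j assume p: "p \<in> P" "hd p = IN k" and "XN j \<in> set p"
  have dp: "distinct q" "dpath G q" if "q \<in> P" for q
    using P that by (auto simp: disjoint_paths_def)
  show "total \<theta> j = axis k 1"
    using \<open>XN j \<in> set p\<close>
  proof (induction j rule: wf_induct_rule[OF wf_EB])
    case (1 j)
    obtain a b where "p = a @ XN j # b" using 1(2) by (meson split_list)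
    moreover from this have "a \<noteq> []" using p by auto
    ultimately obtain a u where ab: "p = a @ u # XN j # b"
      by (cases a rule: rev_cases) auto
    have uG: "(u, XN j) \<in> G"
      using dp(2)[OF p(1)] by (auto simp: ab dpath_def successively_append_iff)
    \<comment> \<open>Disjointness leaves \<open>p\<close> as the only path through this node, and
      distinctness leaves \<open>u\<close> as its only predecessor. The recursion then has a single
      nonzero summand.\<close>
    have F: "(v, XN j) \<in> F \<longleftrightarrow> v = u" for v
    proof
      assume "(v, XN j) \<in> F"
      then obtain q c d where q: "q \<in> P" "q = c @ v # XN j # d" by (auto simp: F_def)
      then have "q = p"
        using P p(1) 1(2) unfolding disjoint_paths_def by fastforce
      then have "(c @ [v]) @ XN j # d = (a @ [u]) @ XN j # b" using q ab by simp
      moreover have "XN j \<notin> set (c @ [v])" "XN j \<notin> set d"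
        using dp(1)[OF q(1)] q(2) by auto
      ultimately have "c @ [v] = a @ [u]" using append_Cons_eq_iff by metis
      then show "v = u" by simp
    qed (use p(1) ab in \<open>auto simp: F_def\<close>)
    have A: "Amat EA \<theta> $ j $ l = (if u = IN l then 1 else 0)" for l
      using uG by (auto simp: Amat_def \<theta>_def F graphG_def)
    have B: "Bmat EB \<theta> $ j $ i = (if u = XN i then 1 else 0)" for i
      using uG by (auto simp: Bmat_def \<theta>_def F graphG_def)
    show ?case
    proof (cases u)
      case (XN i)
      then have "(j, i) \<in> EB" using uG by (auto simp: graphG_def)
      then have IH: "total \<theta> i = axis k 1" using 1(1) XN by (auto simp: ab)
      show ?thesis
        by (subst vec_eq_iff, subst total_rec) (simp add: A B XN if_distrib[of "\<lambda>x. x * _"] IH cong: if_cong)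
    next
      case (IN l)
      \<comment> \<open>Instruments have no incoming edges, so this one must be the head of the
        path.\<close>
      have "a = []"
      proof (cases a rule: rev_cases)
        case (snoc c w)
        then have "(w, IN l) \<in> G"
          using dp(2)[OF p(1)] IN by (auto simp: ab dpath_def successively_append_iff)
        then show ?thesis by (auto simp: graphG_def)
      qed
      then have "l = k" using p(2) IN by (simp add: ab)
      then show ?thesis
        by (subst vec_eq_iff, subst total_rec) (auto simp: A B IN axis_def)
    next
      case YN
      with uG show ?thesis by (auto simp: graphG_def)
    qed
  qed
qed

text \<open>Disjoint paths start at distinct instruments, so the columns at their end points are
  distinct standard basis vectors; \<open>J\<close> collects these end points.\<close>

lemma disjoint_paths_imp_independent:
  assumes P: "disjoint_paths G (range IN) (XN ` W) P"
  obtains J \<theta> where "J \<subseteq> W" "card J = card P" "inj_on (total \<theta>) J" "independent (total \<theta> ` J)"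
proof -
  obtain \<theta> where \<theta>: "\<And>p k j. p \<in> P \<Longrightarrow> hd p = IN k \<Longrightarrow> XN j \<in> set p \<Longrightarrow> total \<theta> j = axis k 1"
    using disjoint_paths_total[OF P] by blast
  have "\<forall>p\<in>P. \<exists>k j. hd p = IN k \<and> last p = XN j \<and> j \<in> W \<and> p \<noteq> []"
    using P by (auto simp: disjoint_paths_def dpath_def)
  then obtain k j where kj: "\<And>p. p \<in> P \<Longrightarrow> hd p = IN (k p) \<and> last p = XN (j p) \<and> j p \<in> W \<and> p \<noteq> []"
    by metis
  have tot: "total \<theta> (j p) = axis (k p) 1" if "p \<in> P" for p
    using \<theta>[OF that] kj[OF that] by (metis last_in_set)
  have "inj_on k P"
  proof (rule inj_onI, rule ccontr)
    fix p q assume pq: "p \<in> P" "q \<in> P" "k p = k q" "p \<noteq> q"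
    then have "hd p \<in> set p \<inter> set q" using kj[of p] kj[of q] by (metis Int_iff hd_in_set)
    then show False using P pq unfolding disjoint_paths_def by blast
  qed
  then have inj: "inj_on (\<lambda>p. total \<theta> (j p)) P"
    by (auto simp: inj_on_def tot axis_eq_axis)
  then have "inj_on j P" by (auto simp: inj_on_def)
  moreover have "inj_on (total \<theta>) (j ` P)"
    using inj by (auto simp: inj_on_def)
  moreover have "total \<theta> ` j ` P \<subseteq> Basis"
    using tot by (auto simp: Basis_vec_def)
  then have "independent (total \<theta> ` j ` P)"
    using independent_Basis independent_mono by blast
  ultimately show ?thesis
    using that[of "j ` P" \<theta>] kj by (auto simp: card_image)
qed

text \<open>Independence at one parameter makes a polynomial Gram determinant nonzero there, hence
  almost everywhere.\<close>

lemma AE_independent: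
  assumes "inj_on (total \<theta>0) J" "independent (total \<theta>0 ` J)"
  shows "AE \<theta> in M0. inj_on (total \<theta>) J \<and> independent (total \<theta> ` J)"
  using polyfun_AE_nonzero[OF finite_param_set polyfun_det_gram, of J total \<theta>0] assms polyfun_total
  by (simp add: det_gram_nonzero_iff)

section \<open>Full column rank: (A1)\<close>

abbreviation "C \<theta> \<equiv> Cmat (Amat EA \<theta>) (Bmat EB \<theta>)"

lemma imS_total: "imS (C \<theta>) S = span (total \<theta> ` S)"
  by (simp add: imS_def total_def)

lemma rankS_total: "rankS (C \<theta>) S = dim (total \<theta> ` S)"
  by (simp add: rankS_def imS_total)

lemma CSw_in_imS: "CSw D S w \<in> imS D S"
  unfolding CSw_def imS_def by (intro span_sum span_scale span_base) auto

lemma AE_A1: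
  assumes "B1 G PA"
  shows "AE \<theta> in M0. A1 (C \<theta>) PA"
proof -
  obtain P where P: "finite P" "card PA \<le> card P"
    "\<forall>p\<in>P. dpath G p \<and> is_instr (hd p) \<and> last p \<in> XN ` PA"
    "\<forall>p\<in>P. \<forall>q\<in>P. p \<noteq> q \<longrightarrow> set p \<inter> set q = {}"
    using assms unfolding B1_def by (elim exE conjE) (rule that)
  then have "disjoint_paths G (range IN) (XN ` PA) P"
    using acyclic_dpath_distinct[OF acyc] by (auto simp: disjoint_paths_def is_instr_iff)
  then obtain J \<theta>0 where J: "J \<subseteq> PA" "card J = card P" "inj_on (total \<theta>0) J" "independent (total \<theta>0 ` J)"
    by (rule disjoint_paths_imp_independent)
  \<comment> \<open>All end points lie in \<open>PA\<close> and there are at least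
    \<open>card PA\<close> of them.\<close>
  then have "J = PA" using P(2) by (simp add: card_seteq)
  from AE_independent[OF J(3,4)] show ?thesis
    by eventually_elim (simp add: \<open>J = PA\<close> A1_def rankS_total dim_eq_card_independent card_image)
qed

section \<open>The outcome vector avoids other images: (A2)\<close>

definition outcome :: "(('d, 'm) pidx \<Rightarrow> real) \<Rightarrow> real^'m" where
  "outcome \<theta> = (\<Sum>i\<in>PA. \<theta> (Bet i) *\<^sub>R total \<theta> i)"

text \<open>This vector is the total effect of the instruments on Y.\<close>

lemma CSw_betavec: "CSw (C \<theta>) PA (\<lambda>j. betavec PA \<theta> $ j) = outcome \<theta>"
  by (simp add: CSw_def outcome_def betavec_def total_def)

text \<open>Column \<open>j\<close> is replaced by the outcome vector. One null set serves all
  \<open>S\<close> and \<open>j\<close>, since the pair used for (A2) is chosen only after the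
  parameter.\<close>

lemma AE_det_gram_outcome:
  "AE \<theta> in M0. \<forall>S j. (\<exists>\<theta>0. det (gram (insert j S) ((total \<theta>0)(j := outcome \<theta>0))) \<noteq> 0)
      \<longrightarrow> det (gram (insert j S) ((total \<theta>)(j := outcome \<theta>))) \<noteq> 0"
proof -
  have poly: "polyfun (param_set EA EB PA) (\<lambda>\<theta>. det (gram (insert j S) ((total \<theta>)(j := outcome \<theta>))))" for S j
  proof (rule polyfun_det_gram)
    fix i k
    have "polyfun (param_set EA EB PA) (\<lambda>\<theta>. outcome \<theta> $ k)"
      unfolding outcome_def sum_component vector_scaleR_component real_scaleR_def
      by (intro polyfun_sum polyfun_mult polyfun_coord polyfun_total) (auto simp: param_set_def)
    then show "polyfun (param_set EA EB PA) (\<lambda>\<theta>. ((total \<theta>)(j := outcome \<theta>)) i $ k)"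
      by (cases "i = j") (auto intro: polyfun_total)
  qed
  have "AE \<theta> in M0. (\<exists>\<theta>0. det (gram (insert j S) ((total \<theta>0)(j := outcome \<theta>0))) \<noteq> 0)
      \<longrightarrow> det (gram (insert j S) ((total \<theta>)(j := outcome \<theta>))) \<noteq> 0" for S j
  proof (cases "\<exists>\<theta>0. det (gram (insert j S) ((total \<theta>0)(j := outcome \<theta>0))) \<noteq> 0")
    case True
    then obtain \<theta>0 where "det (gram (insert j S) ((total \<theta>0)(j := outcome \<theta>0))) \<noteq> 0" ..
    then have "AE \<theta> in M0. det (gram (insert j S) ((total \<theta>)(j := outcome \<theta>))) \<noteq> 0"
      by (rule polyfun_AE_nonzero[OF finite_param_set poly])
    then show ?thesis by eventually_elim simp
  qed simp
  then have "AE \<theta> in M0. \<forall>S\<in>UNIV. \<forall>j\<in>UNIV. (\<exists>\<theta>0. det (gram (insert j S) ((total \<theta>0)(j := outcome \<theta>0))) \<noteq> 0)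
      \<longrightarrow> det (gram (insert j S) ((total \<theta>)(j := outcome \<theta>))) \<noteq> 0"
    by (intro AE_finite_allI finite)
  then show ?thesis by simp
qed

lemma AE_A2: "AE \<theta> in M0. A2 (C \<theta>) PA (betavec PA \<theta>)"
  using AE_det_gram_outcome
proof eventually_elim
  case (elim \<theta>)
  show ?case
    unfolding A2_def
  proof (intro allI impI notI, elim conjE)
    fix S w assume rank: "rankS (C \<theta>) S \<le> rankS (C \<theta>) PA" and im: "imS (C \<theta>) S \<noteq> imS (C \<theta>) PA"
      and eq: "CSw (C \<theta>) S w = CSw (C \<theta>) PA (\<lambda>j. betavec PA \<theta> $ j)"
    \<comment> \<open>Containment together with the rank inequality would force equality of the two
      spaces.\<close>
    have "\<not> imS (C \<theta>) PA \<subseteq> imS (C \<theta>) S"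
      using rank im subspace_dim_equal[of "imS (C \<theta>) PA" "imS (C \<theta>) S"]
      by (auto simp: rankS_def imS_def)
    then have "\<not> total \<theta> ` PA \<subseteq> imS (C \<theta>) S"
      using span_minimal[of "total \<theta> ` PA" "imS (C \<theta>) S"] by (auto simp: imS_total)
    then obtain j where j: "j \<in> PA" "total \<theta> j \<notin> imS (C \<theta>) S" by blast
    \<comment> \<open>Columns indexed by \<open>S\<close> may be dependent, so a basis of their span
      is taken, with an index set \<open>T\<close> on which the columns are distinct.\<close>
    obtain b where b: "b \<subseteq> total \<theta> ` S" "independent b" "total \<theta> ` S \<subseteq> span b"
      using maximal_independent_subset by blast
    then obtain T where T: "T \<subseteq> S" "inj_on (total \<theta>) T" "b = total \<theta> ` T"
      by (auto simp: subset_image_inj)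
    have span_T: "span (total \<theta> ` T) = imS (C \<theta>) S"
      using b T(3) span_mono[of b "total \<theta> ` S"] span_minimal[of "total \<theta> ` S" "span b"]
      by (auto simp: imS_total)
    have "j \<notin> T"
      using j(2) T(1) span_base[of "total \<theta> j" "total \<theta> ` S"] by (auto simp: imS_total)
    text \<open>The outcome at \<open>\<beta> = e\<^sub>j\<close> is the column \<open>j\<close>, which is independent of those in \<open>T\<close>.\<close>
    define \<theta>0 where "\<theta>0 x = (case x of Bet i \<Rightarrow> if i = j then 1 else 0 | _ \<Rightarrow> \<theta> x)" for x
    have tot0: "total \<theta>0 = total \<theta>" by (rule total_cong) (auto simp: \<theta>0_def)
    have "outcome \<theta>0 = (\<Sum>i\<in>PA. if i = j then total \<theta> j else 0)"
      unfolding outcome_def tot0 by (intro sum.cong) (auto simp: \<theta>0_def)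
    then have out0: "outcome \<theta>0 = total \<theta> j" using j(1) by simp
    have "independent (insert (total \<theta> j) (total \<theta> ` T))"
      using j(2) b(2) T(3) span_T by (simp add: independent_insert)
    moreover have "inj_on (total \<theta>) (insert j T)"
      using T(2) j(2) span_T span_superset[of "total \<theta> ` T"] by (auto simp: inj_on_insert)
    ultimately have "det (gram (insert j T) ((total \<theta>0)(j := outcome \<theta>0))) \<noteq> 0"
      unfolding det_gram_nonzero_iff by (simp add: tot0 out0 fun_upd_triv)
    \<comment> \<open>The witness \<open>\<theta>0\<close> shares A and B with
      \<open>\<theta>\<close>; genericity carries the nonzero determinant back to
      \<open>\<theta>\<close> and its own coefficients.\<close>
    with elim have "det (gram (insert j T) ((total \<theta>)(j := outcome \<theta>))) \<noteq> 0" by blast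
    then have "inj_on ((total \<theta>)(j := outcome \<theta>)) (insert j T)"
      "independent (((total \<theta>)(j := outcome \<theta>)) ` insert j T)"
      unfolding det_gram_nonzero_iff by auto
    moreover have "((total \<theta>)(j := outcome \<theta>)) ` T = total \<theta> ` T"
      using \<open>j \<notin> T\<close> by auto
    ultimately have "outcome \<theta> \<notin> span (total \<theta> ` T)"
      using \<open>j \<notin> T\<close> by (auto simp: independent_insert inj_on_insert split: if_splits)
    then show False
      using eq CSw_in_imS[of "C \<theta>" S w] by (simp add: CSw_betavec span_T)
  qed
qed

section \<open>Distinct images for distinct index sets: (A3)\<close>

text \<open>An entry that some path can make nonzero is generically nonzero. Since the right-hand
  side depends on \<open>S\<close> only through the image, different instrument ancestors force
  different images.\<close>

lemma AE_AN_I: "AE \<theta> in M0. \<forall>S. AN_I G S = {k. \<exists>v\<in>imS (C \<theta>) S. v $ k \<noteq> 0}"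
proof -
  have "AE \<theta> in M0. IN k \<in> AN G {XN j} \<longrightarrow> total \<theta> j $ k \<noteq> 0" for k j
  proof (cases "IN k \<in> AN G {XN j}")
    case True
    then obtain p where p: "dpath G p" "hd p = IN k" "last p = XN j" by (auto simp: AN_def)
    then have "disjoint_paths G (range IN) {XN j} {p}"
      using acyclic_dpath_distinct[OF acyc] by (auto simp: disjoint_paths_def)
    then obtain \<theta>0 where "total \<theta>0 j = axis k 1"
      using disjoint_paths_total p by (metis dpath_def insertI1 last_in_set)
    then have "total \<theta>0 j $ k \<noteq> 0" by simp
    then have "AE \<theta> in M0. total \<theta> j $ k \<noteq> 0"
      by (rule polyfun_AE_nonzero[OF finite_param_set polyfun_total])
    then show ?thesis by eventually_elim simp
  qed simp
  then have "AE \<theta> in M0. \<forall>k\<in>UNIV. \<forall>j\<in>UNIV. IN k \<in> AN G {XN j} \<longrightarrow> total \<theta> j $ k \<noteq> 0"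
    by (intro AE_finite_allI finite)
  then show ?thesis
  proof eventually_elim
    case (elim \<theta>)
    then have *: "IN k \<in> AN G {XN j} \<longleftrightarrow> total \<theta> j $ k \<noteq> 0" for k j
      using total_nonzero_imp_dpath[of \<theta> j k] by (auto simp: AN_def)
    have "k \<in> AN_I G S \<longleftrightarrow> (\<exists>v\<in>imS (C \<theta>) S. v $ k \<noteq> 0)" for k S
    proof -
      have "k \<in> AN_I G S \<longleftrightarrow> (\<exists>j\<in>S. total \<theta> j $ k \<noteq> 0)"
        unfolding *[symmetric] by (auto simp: AN_I_def AN_def)
      also have "\<dots> \<longleftrightarrow> \<not> total \<theta> ` S \<subseteq> {v. v $ k = 0}" by auto
      \<comment> \<open>A coordinate hyperplane is a subspace, so testing the columns is the same as
        testing their span.\<close>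
      also have "\<dots> \<longleftrightarrow> \<not> span (total \<theta> ` S) \<subseteq> {v. v $ k = 0}"
      proof -
        have "subspace {v :: real^'m. v $ k = 0}" by (auto simp: subspace_def)
        then show ?thesis by (meson span_minimal span_superset subset_trans)
      qed
      finally show ?thesis by (auto simp: imS_total)
    qed
    then show ?case by auto
  qed
qed

text \<open>Menger supplies \<open>card PA + 1\<close> disjoint paths and so as many generically
  independent columns from \<open>PA \<union> S\<close>. If the images agreed, all of them would lie
  in the span of \<open>card PA\<close> columns.\<close>

lemma AE_imS_neq_if_no_separator:
  assumes sep: "\<And>T. separates G (range IN) (XN ` (PA \<union> S)) T \<Longrightarrow> card PA + 1 \<le> card T"
  shows "AE \<theta> in M0. imS (C \<theta>) S \<noteq> imS (C \<theta>) PA"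
proof -
  obtain P where P: "disjoint_paths G (range IN) (XN ` (PA \<union> S)) P" "card P = card PA + 1"
    using menger[of G "range IN" "XN ` (PA \<union> S)" "card PA + 1"] sep finite_graphG[of EA EB PA] by auto
  obtain J \<theta>0 where J: "J \<subseteq> PA \<union> S" "card J = card P" "inj_on (total \<theta>0) J" "independent (total \<theta>0 ` J)"
    using disjoint_paths_imp_independent[OF P(1)] .
  from AE_independent[OF J(3,4)] show ?thesis
  proof eventually_elim
    case (elim \<theta>)
    show ?case
    proof
      assume "imS (C \<theta>) S = imS (C \<theta>) PA"
      then have "total \<theta> ` (PA \<union> S) \<subseteq> span (total \<theta> ` PA)"
        by (metis imS_total image_Un le_supI span_superset)
      then have "total \<theta> ` J \<subseteq> span (total \<theta> ` PA)" using J(1) by blast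
      then have "card (total \<theta> ` J) \<le> card (total \<theta> ` PA)"
        using elim independent_span_bound[of "total \<theta> ` PA" "total \<theta> ` J"] by auto
      also have "\<dots> \<le> card PA" by (simp add: card_image_le)
      finally show False using elim J(2) P(2) by (simp add: card_image)
    qed
  qed
qed

text \<open>There are finitely many \<open>S\<close>, so each can be treated separately: ancestors
  decide the first alternative of \<open>B3\<close>, Menger the second.\<close>

lemma AE_A3:
  assumes "B3 G PA"
  shows "AE \<theta> in M0. A3 (C \<theta>) PA"
proof -
  have "AE \<theta> in M0. card S = card PA \<and> S \<noteq> PA \<longrightarrow> imS (C \<theta>) S \<noteq> imS (C \<theta>) PA" for S
  proof (cases "card S = card PA \<and> S \<noteq> PA")
    case True
    with assms consider "AN_I G S \<noteq> AN_I G PA"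
      | "\<And>T. separates G (range IN) (XN ` (PA \<union> S)) T \<Longrightarrow> card PA + 1 \<le> card T"
      unfolding B3_def separates_def is_instr_iff by meson
    then show ?thesis
    proof cases
      case 1
      from AE_AN_I show ?thesis
      proof eventually_elim
        case (elim \<theta>)
        then have "AN_I G R = {k. \<exists>v\<in>imS (C \<theta>) R. v $ k \<noteq> 0}" for R by blast
        from this[of S] this[of PA] 1 show ?case by auto
      qed
    next
      case 2
      then have "AE \<theta> in M0. imS (C \<theta>) S \<noteq> imS (C \<theta>) PA"
        by (rule AE_imS_neq_if_no_separator)
      then show ?thesis by eventually_elim simp
    qed
  qed auto
  then have "AE \<theta> in M0. \<forall>S\<in>UNIV. card S = card PA \<and> S \<noteq> PA \<longrightarrow> imS (C \<theta>) S \<noteq> imS (C \<theta>) PA"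
    by (intro AE_finite_allI finite)
  then show ?thesis by (simp add: A3_def)
qed

end

theorem theorem2:
  fixes EA :: "('d::finite \<times> 'm::finite) set"
    and EB :: "('d \<times> 'd) set"
    and PA :: "'d set"
    and \<mu> :: "(('d, 'm) pidx \<Rightarrow> real) measure"
  defines "G \<equiv> graphG EA EB PA"
    and "M0 \<equiv> PiM (param_set EA EB PA) (\<lambda>_. lborel)"
    and "C \<equiv> (\<lambda>\<theta>. Cmat (Amat EA \<theta>) (Bmat EB \<theta>))"
  assumes acyc: "acyclic G"
    and B1: "B1 G PA"
    and prob: "prob_space \<mu>"
    and sets_mu: "sets \<mu> = sets M0"
    and ac: "absolutely_continuous M0 \<mu>"
  shows "(AE \<theta> in \<mu>. A1 (C \<theta>) PA \<and> A2 (C \<theta>) PA (betavec PA \<theta>))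
         \<and> (B3 G PA \<longrightarrow> (AE \<theta> in \<mu>. A3 (C \<theta>) PA))"
proof -
  interpret acyclic_scm EA EB PA
    using acyc unfolding G_def by unfold_locales
  \<comment> \<open>Sets that are null for Lebesgue measure on the free entries are null for
    \<open>\<mu>\<close>, so each almost-everywhere statement carries over.\<close>
  note lift = absolutely_continuous_AE[OF sets_mu ac, unfolded M0_def]
  have "AE \<theta> in \<mu>. A1 (C \<theta>) PA"
    unfolding C_def by (rule lift[OF AE_A1[OF B1[unfolded G_def]]])
  moreover have "AE \<theta> in \<mu>. A2 (C \<theta>) PA (betavec PA \<theta>)"
    unfolding C_def by (rule lift[OF AE_A2])
  moreover have "AE \<theta> in \<mu>. A3 (C \<theta>) PA" if "B3 G PA"
    unfolding C_def by (rule lift[OF AE_A3[OF that[unfolded G_def]]])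
  ultimately show ?thesis by auto
qed

end
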